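(* Let $A$ be an expansive $n\times n$ integer matrix. There exists a compact set $K\subset\mathbb{R}^n$ with $0\in K^\circ$ which tiles $\mathbb{R}^n$ by $\mathbb{Z}^n$ translations and such that $AK\supset K$.
   Context: An $n\times n$ integer matrix is expansive if all of its (complex) eigenvalues have modulus larger than $1$. $K^\circ$ denotes the interior of $K$. A measurable set $K$ tiles $\mathbb{R}^n$ by $\mathbb{Z}^n$ translations if $\sum_{k\in\mathbb{Z}^n} I_K(x+k)=1$ for almost every $x\in\mathbb{R}^n$, where $I_K$ is the indicator function of $K$. *)

theory Defs
  imports "HOL-Analysis.Analysis"
begin

definition eigenvalue :: "'a::field ^ 'n ^ 'n \<Rightarrow> 'a \<Rightarrow> bool" where
  "eigenvalue A z \<longleftrightarrow> (\<exists>v. v \<noteq> 0 \<and> A *v v = z *s v)"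

text \<open>The eigenvalues meant here are the complex ones, so the integer entries are first
  cast to \<^typ>\<open>complex\<close>.\<close>

definition expansive :: "int ^ 'n ^ 'n \<Rightarrow> bool" where
  "expansive A \<longleftrightarrow> (\<forall>z::complex. eigenvalue (map_matrix of_int A) z \<longrightarrow> 1 < cmod z)"

definition integer_lattice :: "(real ^ 'n) set" where
  "integer_lattice = {k. \<forall>i. k $ i \<in> \<int>}"

definition tiles :: "(real ^ 'n) set \<Rightarrow> bool" where
  "tiles K \<longleftrightarrow> K \<in> sets lebesgue \<and>
     (AE x in lebesgue. ((\<lambda>k. indicat_real K (x + k)) has_sum 1) integer_lattice)"

end

theory Submission
  imports Defs "HOL-Computational_Algebra.Fundamental_Theorem_Algebra"
begin

text \<open>
  Put $T = A^{-1}$.  The inclusion $K \<subseteq> AK$ says that $TK \<subseteq> K$, and a tile is a choice of one point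
  from almost every coset of $\<int>^n$.  If the choice is always a minimal point of the coset for some
  order, then $TK \<subseteq> K$ holds as soon as $T$ preserves the order: if $x$ is minimal among the $x + k$,
  then $Tx$ is minimal among the $T (x + Ak) = Tx + k$, because $Ak$ is a lattice vector.

  The eigenvalue condition gives $T^m x \<rightarrow> 0$ for every $x$
  (\<open>expansive_inverse_powers_tendsto_0\<close>), hence a small open convex neighbourhood $U$ of the origin with
  $TU \<subseteq> U$ (\<open>contracting_imp_invariant_neighbourhood\<close>).  The sets $D_m = A^m U$ increase to the whole
  space, and $T$ maps the shell $D_{m+1} \<setminus> D_m$ onto the preceding one.  Points are ordered by
  shells, the set $D_0 = U$ coming first, and within a shell by the Euclidean length of $T^m x$, that is,
  after moving the shell back to $D_1 \<setminus> D_0$.  Then $T$ preserves the order on and between all shells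
  but the innermost, which it moves into $U$; there it does no harm, because $U$ contains at most one
  point of each coset and $TU \<subseteq> U$ (\<open>T_pretile\<close>).

  The minimal points form a bounded set that contains $U$ and meets every coset.  Two minimal points in
  one coset have equal length after applying some $T^m$, which confines them to countably many
  hyperplanes; taking the closure adds only points on the boundaries of the convex sets $D_m$
  (\<open>closure_pretile_subset\<close>).  Both effects are confined to null sets, so the closure is the required
  compact tile.
\<close>

section \<open>Powers of the inverse of an expansive matrix\<close>

text \<open>The matrix polynomial $p(B)$ applied to the vector $v$, evaluated by Horner's scheme, so that no
  ring structure on matrices is involved.\<close>
definition poly_act :: "complex ^ 'n ^ 'n \<Rightarrow> complex poly \<Rightarrow> complex ^ 'n \<Rightarrow> complex ^ 'n" where
  "poly_act B p v = fold_coeffs (\<lambda>c w. c *s v + B *v w) p 0"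

lemma poly_act_0 [simp]: "poly_act B 0 v = 0"
  by (simp add: poly_act_def)

lemma poly_act_pCons [simp]: "poly_act B (pCons a p) v = a *s v + B *v poly_act B p v"
  by (cases "a = 0 \<and> p = 0") (auto simp: poly_act_def fold_coeffs_pCons_coeff_not_0_eq fold_coeffs_pCons_not_0_0_eq)

lemma poly_act_add: "poly_act B (p + q) v = poly_act B p v + poly_act B q v"
  by (induction p q rule: poly_induct2)
     (auto simp: matrix_vector_right_distrib vec.scale_left_distrib algebra_simps)

lemma poly_act_smult: "poly_act B (smult c p) v = c *s poly_act B p v"
  by (induction p) (auto simp: vec.scale vec.scale_right_distrib)

lemma poly_act_diff_right: "poly_act B p (v - w) = poly_act B p v - poly_act B p w"
  by (induction p) (simp_all add: vec.diff vec.scale_right_diff_distrib add_diff_add)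

lemma poly_act_scale_right: "poly_act B p (c *s v) = c *s poly_act B p v"
  by (induction p) (auto simp: vec.scale vec.scale_right_distrib mult.commute)

lemma poly_act_commute: "poly_act B p (B *v v) = B *v poly_act B p v"
  by (induction p) (auto simp: vec.scale matrix_vector_right_distrib)

lemma poly_act_sum: "poly_act B (\<Sum>i\<in>I. p i) v = (\<Sum>i\<in>I. poly_act B (p i) v)"
  by (induction I rule: infinite_finite_induct) (auto simp: poly_act_add)

lemma poly_act_monom: "poly_act B (monom c i) v = c *s ((*v) B ^^ i) v"
  by (induction i) (auto simp: monom_0 monom_Suc vec.scale)

text \<open>This is what lets an annihilating polynomial be peeled off one complex root at a time.\<close>
lemma poly_act_linear_factor:
  "poly_act B ([:- z, 1:] * q) v = B *v poly_act B q v - z *s poly_act B q v"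
proof -
  have "[:- z, 1:] * q = smult (- z) q + pCons 0 q"
    by simp
  then show ?thesis
    by (simp only: poly_act_add poly_act_smult poly_act_pCons) (simp add: algebra_simps)
qed

text \<open>The $n + 1$ vectors $v, Bv, \<dots>, B^n v$ are linearly dependent; the coefficients of a dependency
  are those of the polynomial.  A repetition $B^i v = B^j v$ must be treated apart, because dependence
  is a property of the set of these vectors.\<close>
lemma annihilating_poly_exists:
  fixes B :: "complex ^ 'n ^ 'n"
  obtains p where "p \<noteq> 0" "poly_act B p v = 0"
proof -
  define w where "w i = ((*v) B ^^ i) v" for i
  define N where "N = CARD('n)"
  show thesis
  proof (cases "inj_on w {..N}")
    case False
    then obtain i j where ij: "i \<noteq> j" "w i = w j"
      by (auto simp: inj_on_def)
    have "coeff (monom 1 i + monom (-1) j :: complex poly) i = 1"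
      using ij by simp
    then have "monom 1 i + monom (-1) j \<noteq> (0 :: complex poly)"
      by (metis coeff_0 zero_neq_one)
    moreover have "poly_act B (monom 1 i + monom (-1) j) v = 0"
      using ij by (simp add: poly_act_add poly_act_monom w_def)
    ultimately show thesis
      using that by blast
  next
    case True
    have "vec.dim (w ` {..N}) \<le> N"
      using vec.dim_subset_UNIV[of "w ` {..N}"] by (simp add: N_def vec.dimension_def card_cart_basis)
    moreover have "card (w ` {..N}) = Suc N"
      using True by (simp add: card_image)
    ultimately have "vec.dependent (w ` {..N})"
      using vec.independent_card_le_dim[of "w ` {..N}" "w ` {..N}"] by auto
    then obtain u where u: "\<exists>i\<in>{..N}. u (w i) \<noteq> 0" "(\<Sum>x\<in>w ` {..N}. u x *s x) = 0"
      by (auto simp: vec.dependent_finite)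
    define p where "p = (\<Sum>i\<le>N. monom (u (w i)) i)"
    obtain i where i: "i \<le> N" "u (w i) \<noteq> 0"
      using u by auto
    have "coeff p i = u (w i)"
      using i by (simp add: p_def coeff_sum)
    then have "p \<noteq> 0"
      using i by auto
    moreover have "poly_act B p v = (\<Sum>i\<le>N. u (w i) *s w i)"
      by (simp add: p_def poly_act_sum poly_act_monom w_def)
    then have "poly_act B p v = 0"
      using u(2) True by (simp add: sum.reindex)
    ultimately show thesis
      using that by blast
  qed
qed

lemma norm_vec_scale_complex: "norm (z *s (v :: complex ^ 'n)) = cmod z * norm v"
  by (simp add: norm_vec_def norm_mult L2_set_right_distrib)

text \<open>Once the perturbation stays below $(1 - r) e / 2$, the number $e / 2$ is a fixed point of the
  majorising recursion, and the distance to it shrinks geometrically.\<close>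
lemma perturbed_geometric_tendsto_0:
  fixes a b :: "nat \<Rightarrow> real"
  assumes "0 \<le> r" "r < 1" and a: "\<And>m. 0 \<le> a m" and step: "\<And>m. a (Suc m) \<le> r * a m + b m"
    and b: "b \<longlonglongrightarrow> 0"
  shows "a \<longlonglongrightarrow> 0"
proof (rule LIMSEQ_I)
  fix e :: real assume "0 < e"
  define d where "d = (1 - r) * e / 2"
  have "0 < d" using \<open>0 < e\<close> assms by (simp add: d_def)
  obtain M where M: "\<And>m. M \<le> m \<Longrightarrow> \<bar>b m\<bar> < d"
    using LIMSEQ_D[OF b \<open>0 < d\<close>] by auto
  have geo: "a (M + i) \<le> r ^ i * a M + e / 2" for i
  proof (induction i)
    case 0
    then show ?case using \<open>0 < e\<close> by simp
  next
    case (Suc i)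
    have "a (M + Suc i) \<le> r * a (M + i) + d"
      using step[of "M + i"] M[of "M + i"] by simp
    also have "\<dots> \<le> r * (r ^ i * a M + e / 2) + d"
      using Suc assms(1) mult_left_mono by simp
    also have "\<dots> = r ^ Suc i * a M + e / 2"
      by (simp add: d_def field_simps)
    finally show ?case .
  qed
  have "(\<lambda>i. r ^ i * a M) \<longlonglongrightarrow> 0"
    using assms by (intro tendsto_mult_left_zero LIMSEQ_power_zero) auto
  from LIMSEQ_D[OF this, of "e / 2"] obtain I where I: "\<And>i. I \<le> i \<Longrightarrow> \<bar>r ^ i * a M\<bar> < e / 2"
    using \<open>0 < e\<close> by auto
  have "norm (a m - 0) < e" if "m \<ge> M + I" for m
  proof -
    have "I \<le> m - M" "M + (m - M) = m"
      using that by auto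
    then show ?thesis
      using geo[of "m - M"] I[of "m - M"] a[of m] by auto
  qed
  then show "\<exists>no. \<forall>n\<ge>no. norm (a n - 0) < e" by blast
qed

lemma funpow_matrix_diff:
  fixes B :: "complex ^ 'n ^ 'n"
  shows "((*v) B ^^ m) (v - w) = ((*v) B ^^ m) v - ((*v) B ^^ m) w"
  by (induction m) (auto simp: vec.diff)

lemma funpow_matrix_scale:
  fixes B :: "complex ^ 'n ^ 'n"
  shows "((*v) B ^^ m) (z *s v) = z *s ((*v) B ^^ m) v"
  by (induction m) (auto simp: vec.scale)

text \<open>Induction on the degree of a polynomial $p \<noteq> 0$ with $p(B) v = 0$.  Split off a root,
  $p = (X - z) q$.  If $z$ is not an eigenvalue, then $B - z$ is injective and already $q(B) v = 0$.
  If $z$ is an eigenvalue, then $q$ annihilates $w = (B - z) v$, hence $B^m w \<rightarrow> 0$, and the recursion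
  $B^{m+1} v = z B^m v + B^m w$ with $|z| < 1$ carries this over to $v$.\<close>
proposition powers_tendsto_0_if_eigenvalues_in_disc:
  fixes B :: "complex ^ 'n ^ 'n"
  assumes ev: "\<And>z. eigenvalue B z \<Longrightarrow> cmod z < 1"
  shows "(\<lambda>m. ((*v) B ^^ m) v) \<longlonglongrightarrow> 0"
proof -
  have "(\<lambda>m. ((*v) B ^^ m) v) \<longlonglongrightarrow> 0" if "p \<noteq> 0" "poly_act B p v = 0" for p v
    using that
  proof (induction "degree p" arbitrary: p v)
    case 0
    then obtain a where "p = [:a:]" "a \<noteq> 0"
      by (metis degree_eq_zeroE pCons_0_0)
    then have "v = 0"
      using 0 by simp
    have "((*v) B ^^ m) 0 = 0" for m
      by (induction m) auto
    then show ?case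
      using \<open>v = 0\<close> by simp
  next
    case (Suc d)
    obtain z where "poly p z = 0"
      using fundamental_theorem_of_algebra[of p] Suc(2) constant_degree[of p] by auto
    then obtain q where p: "p = [:- z, 1:] * q"
      by (auto simp: poly_eq_0_iff_dvd dvd_def)
    have "q \<noteq> 0"
      using Suc.prems p by auto
    then have "degree p = Suc (degree q)"
      unfolding p by (subst degree_mult_eq) auto
    then have d: "d = degree q"
      using Suc(2) by simp
    show ?case
    proof (cases "eigenvalue B z")
      case False
      have "B *v poly_act B q v = z *s poly_act B q v"
        using Suc.prems(2) unfolding p poly_act_linear_factor by simp
      then have "poly_act B q v = 0"
        using False by (auto simp: eigenvalue_def)
      then show ?thesis
        using Suc(1) d \<open>q \<noteq> 0\<close> by blast
    next
      case True
      then have z: "cmod z < 1"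
        using ev by blast
      define w where "w = B *v v - z *s v"
      have "poly_act B q w = poly_act B p v"
        unfolding p poly_act_linear_factor w_def
        by (simp add: poly_act_diff_right poly_act_scale_right poly_act_commute)
      then have w: "(\<lambda>m. ((*v) B ^^ m) w) \<longlonglongrightarrow> 0"
        using Suc(1) d \<open>q \<noteq> 0\<close> Suc.prems(2) by simp
      have "((*v) B ^^ Suc m) v = z *s ((*v) B ^^ m) v + ((*v) B ^^ m) w" for m
        by (simp add: w_def funpow_matrix_diff funpow_matrix_scale funpow_swap1 del: funpow.simps)
           (simp add: funpow_swap1)
      then have step: "norm (((*v) B ^^ Suc m) v) \<le> cmod z * norm (((*v) B ^^ m) v) + norm (((*v) B ^^ m) w)" for m
        using norm_triangle_ineq[of "z *s ((*v) B ^^ m) v" "((*v) B ^^ m) w"]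
        by (simp only: norm_vec_scale_complex)
      have "(\<lambda>m. norm (((*v) B ^^ m) v)) \<longlonglongrightarrow> 0"
        by (rule perturbed_geometric_tendsto_0[OF norm_ge_zero z norm_ge_zero step tendsto_norm_zero[OF w]])
      then show ?thesis
        by (rule tendsto_norm_zero_cancel)
    qed
  qed
  moreover obtain p where "p \<noteq> 0" "poly_act B p v = 0"
    using annihilating_poly_exists .
  ultimately show ?thesis
    by blast
qed

lemma map_matrix_of_int_vec_of_real:
  "map_matrix of_int A *v (\<chi> i. complex_of_real (x $ i)) =
    (\<chi> i. complex_of_real ((map_matrix real_of_int A *v x) $ i))"
  by (simp add: vec_eq_iff matrix_vector_mult_def)

text \<open>The eigenvalues of $A^{-1}$ are the reciprocals of those of $A$, so the complex result applies to
  the inverse of the complexified matrix; that inverse acts on real vectors like the real one.\<close>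
proposition expansive_inverse_powers_tendsto_0:
  fixes A :: "int ^ 'n ^ 'n"
  assumes "expansive A"
  obtains T :: "real ^ 'n \<Rightarrow> real ^ 'n" where
    "linear T" "\<And>x. T (map_matrix real_of_int A *v x) = x" "\<And>x. map_matrix real_of_int A *v T x = x"
    "\<And>x. (\<lambda>m. (T ^^ m) x) \<longlonglongrightarrow> 0"
proof -
  define C :: "complex ^ 'n ^ 'n" where "C = map_matrix of_int A"
  define R :: "real ^ 'n ^ 'n" where "R = map_matrix real_of_int A"
  define c :: "real ^ 'n \<Rightarrow> complex ^ 'n" where "c x = (\<chi> i. complex_of_real (x $ i))" for x
  have C_c: "C *v c x = c (R *v x)" for x
    unfolding C_def R_def c_def by (rule map_matrix_of_int_vec_of_real)
  have ev: "1 < cmod z" if "eigenvalue C z" for z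
    using assms that by (auto simp: expansive_def C_def)
  have C0: "v = 0" if "C *v v = 0" for v
    using ev[of 0] that by (force simp: eigenvalue_def)
  have "inj ((*v) C)"
    using C0 by (metis vec.inj_iff_eq_0)
  then obtain B where BC: "B ** C = mat 1"
    by (auto simp: matrix_left_invertible_injective[symmetric])
  have B_C: "B *v (C *v v) = v" and C_B: "C *v (B *v v) = v" for v
    using BC matrix_left_right_inverse by (metis matrix_vector_mul_assoc matrix_vector_mul_lid)+
  have "R *v x = 0 \<Longrightarrow> x = 0" for x
    using C_c[of x] C0[of "c x"] by (auto simp: c_def vec_eq_iff)
  then have "inj ((*v) R)"
    by (metis vec.inj_iff_eq_0)
  then obtain Q where QR: "Q ** R = mat 1"
    by (auto simp: matrix_left_invertible_injective[symmetric])
  have Q_R: "Q *v (R *v x) = x" and R_Q: "R *v (Q *v x) = x" for x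
    using QR matrix_left_right_inverse by (metis matrix_vector_mul_assoc matrix_vector_mul_lid)+
  have B_c: "B *v c x = c (Q *v x)" for x
    by (metis B_C C_c R_Q)
  have B_pow: "((*v) B ^^ m) (c x) = c (((*v) Q ^^ m) x)" for m x
    by (induction m) (auto simp: B_c)
  have "cmod z < 1" if z: "eigenvalue B z" for z
  proof -
    obtain v where v: "v \<noteq> 0" "B *v v = z *s v"
      using z by (auto simp: eigenvalue_def)
    have "z \<noteq> 0"
      using v C_B[of v] by auto
    have "v = z *s (C *v v)"
      using v C_B[of v] by (metis vec.scale)
    then have "C *v v = (1 / z) *s v"
      using \<open>z \<noteq> 0\<close> by (metis divide_self_if vec.scale_one vec.scale_scale times_divide_eq_left mult_1)
    then have "1 < cmod (1 / z)"
      using v by (intro ev) (auto simp: eigenvalue_def)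
    then show ?thesis
      using \<open>z \<noteq> 0\<close> by (simp add: norm_divide)
  qed
  then have "(\<lambda>m. ((*v) B ^^ m) v) \<longlonglongrightarrow> 0" for v
    using powers_tendsto_0_if_eigenvalues_in_disc by blast
  then have lim: "(\<lambda>m. c (((*v) Q ^^ m) x)) \<longlonglongrightarrow> 0" for x
    unfolding B_pow[symmetric] by blast
  have "(\<lambda>m. ((*v) Q ^^ m) x) \<longlonglongrightarrow> 0" for x
  proof (rule vec_tendstoI)
    fix i
    have "(\<lambda>m. Re (c (((*v) Q ^^ m) x) $ i)) \<longlonglongrightarrow> Re (0 $ i)"
      by (intro tendsto_intros lim)
    then show "(\<lambda>m. ((*v) Q ^^ m) x $ i) \<longlonglongrightarrow> 0 $ i"
      by (simp add: c_def)
  qed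
  then show thesis
    using that[of "(*v) Q"] Q_R R_Q by (simp add: R_def)
qed

section \<open>The integer lattice\<close>

lemma integer_lattice_eq: "integer_lattice = range (\<lambda>z :: int ^ 'n. \<chi> i. real_of_int (z $ i))"
proof (intro equalityI subsetI)
  fix k :: "real ^ 'n" assume "k \<in> integer_lattice"
  then have "k = (\<chi> i. real_of_int ((\<chi> i. \<lfloor>k $ i\<rfloor>) $ i))"
    by (simp add: integer_lattice_def vec_eq_iff)
  then show "k \<in> range (\<lambda>z :: int ^ 'n. \<chi> i. real_of_int (z $ i))"
    by blast
qed (auto simp: integer_lattice_def)

lemma countable_integer_lattice: "countable integer_lattice"
  unfolding integer_lattice_eq by simp

lemma zero_integer_lattice [simp]: "0 \<in> integer_lattice"
  by (simp add: integer_lattice_def)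

lemma integer_lattice_add: "k \<in> integer_lattice \<Longrightarrow> l \<in> integer_lattice \<Longrightarrow> k + l \<in> integer_lattice"
  by (simp add: integer_lattice_def)

lemma integer_lattice_minus: "k \<in> integer_lattice \<Longrightarrow> - k \<in> integer_lattice"
  by (simp add: integer_lattice_def)

lemma integer_lattice_diff: "k \<in> integer_lattice \<Longrightarrow> l \<in> integer_lattice \<Longrightarrow> k - l \<in> integer_lattice"
  by (simp add: integer_lattice_def)

lemma matrix_maps_integer_lattice:
  "k \<in> integer_lattice \<Longrightarrow> map_matrix real_of_int A *v k \<in> integer_lattice"
  by (auto simp: integer_lattice_def matrix_vector_mult_def intro!: Ints_sum Ints_mult)

lemma integer_lattice_norm_less_1:
  assumes "k \<in> integer_lattice" "norm k < 1"
  shows "k = 0"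
proof -
  have "k $ i = 0" for i
  proof -
    have "\<bar>k $ i\<bar> < 1"
      using component_le_norm_cart[of k i] assms(2) by linarith
    then show ?thesis
      using assms(1) by (auto simp: integer_lattice_def elim: Ints_nonzero_abs_less1)
  qed
  then show ?thesis
    by (simp add: vec_eq_iff)
qed

lemma finite_integer_lattice_Int_bounded:
  fixes B :: "(real ^ 'n) set"
  assumes "bounded B"
  shows "finite (integer_lattice \<inter> B)"
proof -
  obtain b where b: "\<And>x. x \<in> B \<Longrightarrow> norm x \<le> b"
    using assms by (auto simp: bounded_iff)
  define F :: "('n \<Rightarrow> int) set" where "F = Pi\<^sub>E UNIV (\<lambda>_. {- \<lceil>b\<rceil>..\<lceil>b\<rceil>})"
  have "k \<in> (\<lambda>f. \<chi> i. real_of_int (f i)) ` F" if "k \<in> integer_lattice \<inter> B" for k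
  proof
    show "k = (\<chi> i. real_of_int \<lfloor>k $ i\<rfloor>)"
      using that by (simp add: integer_lattice_def vec_eq_iff)
    have "\<bar>k $ i\<bar> \<le> b" for i
      using component_le_norm_cart[of k i] b[of k] that by auto
    then have "- b \<le> k $ i \<and> k $ i \<le> b" for i
      by (simp add: abs_le_iff minus_le_iff)
    then have "- \<lceil>b\<rceil> \<le> \<lfloor>k $ i\<rfloor> \<and> \<lfloor>k $ i\<rfloor> \<le> \<lceil>b\<rceil>" for i
      by (metis ceiling_def floor_mono floor_le_ceiling minus_minus neg_le_iff_le order_trans)
    then show "(\<lambda>i. \<lfloor>k $ i\<rfloor>) \<in> F"
      by (auto simp: F_def)
  qed
  moreover have "finite F"
    by (auto simp: F_def intro: finite_PiE)
  ultimately show ?thesis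
    by (meson finite_imageI finite_subset subsetI)
qed

lemma integer_lattice_translate_into_cube:
  obtains k where "k \<in> integer_lattice" "(x :: real ^ 'n) + k \<in> cbox 0 1"
proof
  show "(\<chi> i. - real_of_int \<lfloor>x $ i\<rfloor>) \<in> integer_lattice"
    by (simp add: integer_lattice_def)
  show "x + (\<chi> i. - real_of_int \<lfloor>x $ i\<rfloor>) \<in> cbox 0 1"
    by (auto simp: mem_box_cart) linarith+
qed

section \<open>A neighbourhood of the origin mapped into itself\<close>

lemma linear_funpow:
  fixes T :: "'a::real_vector \<Rightarrow> 'a"
  shows "linear T \<Longrightarrow> linear (T ^^ m)"
  by (induction m) (auto simp: linear_id intro: linear_compose)

text \<open>Some power $T^p$ with $p > 0$ does not increase the norm.  The points whose first $p$ iterates all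
  lie in the ball then form an invariant set: of the iterates of $Tx$, only $T^p x$ is new, and it
  is no longer than $x$.  As an intersection of preimages of a ball the set is open and convex.\<close>
lemma contracting_imp_invariant_neighbourhood:
  fixes T :: "'a::euclidean_space \<Rightarrow> 'a"
  assumes T: "linear T" and lim: "\<And>x. (\<lambda>m. (T ^^ m) x) \<longlonglongrightarrow> 0" and "0 < r"
  obtains U where "open U" "convex U" "U \<subseteq> ball 0 r" "0 \<in> U" "T ` U \<subseteq> U"
proof -
  have "(\<lambda>m. \<Sum>b\<in>Basis. norm ((T ^^ m) b)) \<longlonglongrightarrow> (\<Sum>b\<in>(Basis :: 'a set). 0)"
    by (intro tendsto_sum tendsto_norm_zero lim)
  then have "\<forall>\<^sub>F m in sequentially. (\<Sum>b\<in>Basis. norm ((T ^^ m) b)) < 1"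
    by (rule order_tendstoD) simp
  then obtain p where "0 < p" and p: "(\<Sum>b\<in>Basis. norm ((T ^^ p) b)) < 1"
    by (metis (mono_tags, lifting) eventually_sequentially le_SucI zero_less_Suc le_refl)
  have nonexp: "norm ((T ^^ p) x) \<le> norm x" for x
  proof -
    have "(T ^^ p) x = (T ^^ p) (\<Sum>b\<in>Basis. (x \<bullet> b) *\<^sub>R b)"
      by (simp add: euclidean_representation)
    also have "\<dots> = (\<Sum>b\<in>Basis. (x \<bullet> b) *\<^sub>R (T ^^ p) b)"
      using linear_funpow[OF T, of p] by (simp add: linear_sum linear_scale)
    also have "norm \<dots> \<le> (\<Sum>b\<in>Basis. norm x * norm ((T ^^ p) b))"
      by (rule sum_norm_le) (simp add: Basis_le_norm mult_right_mono)
    also have "\<dots> = norm x * (\<Sum>b\<in>Basis. norm ((T ^^ p) b))"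
      by (simp add: sum_distrib_left)
    also have "\<dots> \<le> norm x"
      using p by (simp add: mult_left_le)
    finally show ?thesis .
  qed
  define U where "U = (\<Inter>j<p. (T ^^ j) -` ball 0 r)"
  have "continuous_on UNIV (T ^^ j)" for j
    using linear_funpow[OF T] linear_conv_bounded_linear linear_continuous_on by blast
  then have "open U"
    unfolding U_def by (intro open_INT) (auto intro: open_vimage)
  moreover have "convex U"
    unfolding U_def by (intro convex_INT convex_linear_vimage linear_funpow T convex_ball)
  moreover have "U \<subseteq> ball 0 r"
    using \<open>0 < p\<close> by (auto simp: U_def)
  moreover have "0 \<in> U"
    using \<open>0 < r\<close> by (auto simp: U_def linear_0[OF linear_funpow[OF T]])
  moreover have "T x \<in> U" if x: "x \<in> U" for x
  proof -
    have "norm ((T ^^ j) (T x)) < r" if "j < p" for j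
    proof (cases "Suc j < p")
      case True
      then have "norm ((T ^^ Suc j) x) < r"
        using x by (simp add: U_def del: funpow.simps)
      then show ?thesis
        by (simp add: funpow_swap1)
    next
      case False
      then have "(T ^^ j) (T x) = (T ^^ p) x"
        using that by (metis Suc_lessI comp_apply funpow_Suc_right)
      moreover have "norm x < r"
        using x \<open>U \<subseteq> ball 0 r\<close> by auto
      ultimately show ?thesis
        using nonexp[of x] by simp
    qed
    then show ?thesis
      by (simp add: U_def)
  qed
  ultimately show thesis
    using that by blast
qed

section \<open>The tile\<close>

lemma negligible_Union_countable_family:
  assumes "countable I" "\<And>i. i \<in> I \<Longrightarrow> negligible (f i)"
  shows "negligible (\<Union>i\<in>I. f i)"
  using assms by (intro negligible_countable_Union) auto

text \<open>Here $T$ stands for the inverse of an expansive integer matrix, $S$ for the matrix itself, and $U$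
  for an invariant neighbourhood of the origin that is small enough to meet each coset of the
  integer lattice at most once.\<close>
locale lattice_contraction =
  fixes T S :: "real ^ 'n \<Rightarrow> real ^ 'n" and U :: "(real ^ 'n) set"
  assumes linear_T: "linear T" and linear_S: "linear S"
    and S_T [simp]: "S (T x) = x" and T_S [simp]: "T (S x) = x"
    and S_lattice: "k \<in> integer_lattice \<Longrightarrow> S k \<in> integer_lattice"
    and open_U: "open U" and convex_U: "convex U" and bounded_U: "bounded U"
    and zero_U: "0 \<in> U" and T_U: "T ` U \<subseteq> U"
    and absorbing: "\<exists>m. (T ^^ m) x \<in> U"
    and packing: "\<lbrakk>x \<in> U; x + k \<in> U; k \<in> integer_lattice\<rbrakk> \<Longrightarrow> k = 0"
begin

text \<open>The sets $S^m U$; they increase with $m$ and exhaust the space.\<close>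
definition D :: "nat \<Rightarrow> (real ^ 'n) set" where
  "D m = (T ^^ m) -` U"

text \<open>Order points lexicographically, first by the least $m$ for which $D_m$ contains them, then, inside
  the shell $D_{m+1} \<setminus> D_m$, by the length of $T^m x$.  For $x$ in that shell this predicate says
  that $x$ does not come after $y$.  The tie-breaking length is measured after pulling the shell back to
  $D_1 \<setminus> D_0$, and this makes the order compatible with $T$.\<close>
definition preferred :: "nat \<Rightarrow> real ^ 'n \<Rightarrow> real ^ 'n \<Rightarrow> bool" where
  "preferred m x y \<longleftrightarrow> y \<notin> D m \<and> (y \<in> D (Suc m) \<longrightarrow> norm ((T ^^ m) x) \<le> norm ((T ^^ m) y))"

text \<open>The choice $k = 0$ of the lattice vector forces $x \<notin> D_m$, so these points do lie in the shell.\<close>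
definition shell_reps :: "nat \<Rightarrow> (real ^ 'n) set" where
  "shell_reps m = {x \<in> D (Suc m). \<forall>k\<in>integer_lattice. preferred m x (x + k)}"

definition pretile :: "(real ^ 'n) set" where
  "pretile = D 0 \<union> (\<Union>m. shell_reps m)"

lemma linear_T_pow: "linear (T ^^ m)"
  by (rule linear_funpow[OF linear_T])

lemma continuous_on_T_pow: "continuous_on X (T ^^ m)"
  using linear_T_pow linear_conv_bounded_linear linear_continuous_on by blast

lemma S_pow_T_pow [simp]: "(S ^^ m) ((T ^^ m) x) = x"
  by (induction m arbitrary: x) (simp_all add: funpow_swap1)

lemma inj_T_pow: "inj (T ^^ m)"
  by (metis S_pow_T_pow injI)

lemma D_0: "D 0 = U"
  by (simp add: D_def)

lemma T_mem_D_iff: "T x \<in> D m \<longleftrightarrow> x \<in> D (Suc m)"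
  by (simp add: D_def funpow_swap1)

lemma open_D: "open (D m)"
  unfolding D_def by (intro open_vimage open_U continuous_on_T_pow)

lemma convex_D: "convex (D m)"
  unfolding D_def by (intro convex_linear_vimage linear_T_pow convex_U)

lemma bounded_D: "bounded (D m)"
proof -
  have "D m \<subseteq> (S ^^ m) ` U"
    unfolding D_def by (metis S_pow_T_pow image_eqI subsetI vimageD)
  moreover have "bounded ((S ^^ m) ` U)"
    using linear_funpow[OF linear_S] bounded_U bounded_linear_image linear_conv_bounded_linear by blast
  ultimately show ?thesis
    using bounded_subset by blast
qed

lemma D_mono: "m \<le> m' \<Longrightarrow> D m \<subseteq> D m'"
  by (rule lift_Suc_mono_le[of D]) (use T_U in \<open>auto simp: D_def\<close>)

lemma D_exhausts: "(\<Union>m. D m) = UNIV"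
  using absorbing by (auto simp: D_def)

text \<open>$T$ moves each shell one step inwards and preserves the order there.  The competitors of $Tx$ are
  the points $Tx + k = T (x + Sk)$, and $Sk$ is again a lattice vector, so each of them is the image
  of a competitor that $x$ does not come after.  This is where the integrality of the matrix enters.\<close>
lemma T_pretile: "T ` pretile \<subseteq> pretile"
proof
  fix y assume "y \<in> T ` pretile"
  then obtain x where x: "x \<in> pretile" "y = T x"
    by blast
  show "y \<in> pretile"
  proof (cases "y \<in> D 0")
    case False
    then have "x \<notin> D 0"
      using x T_U by (auto simp: D_0)
    then obtain m where m: "x \<in> shell_reps m"
      using x by (auto simp: pretile_def)
    then obtain j where "m = Suc j"
      using False x(2) T_mem_D_iff[of x 0] by (cases m) (auto simp: shell_reps_def)
    have "preferred j (T x) (T x + k)" if "k \<in> integer_lattice" for k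
    proof -
      have "T x + k = T (x + S k)"
        by (simp add: linear_add[OF linear_T])
      moreover have "preferred m x (x + S k)"
        using m S_lattice[OF that] by (simp add: shell_reps_def)
      ultimately show ?thesis
        by (simp add: preferred_def T_mem_D_iff \<open>m = Suc j\<close> funpow_swap1)
    qed
    then have "T x \<in> shell_reps j"
      using m by (simp add: shell_reps_def T_mem_D_iff \<open>m = Suc j\<close>)
    then show ?thesis
      using x by (auto simp: pretile_def)
  qed (simp add: pretile_def)
qed

text \<open>Among the translates of $x$ take those in the first $D_n$ that any translate meets.  There are
  finitely many of them, so one is minimal.\<close>
lemma pretile_covers:
  obtains k where "k \<in> integer_lattice" "x + k \<in> pretile"
proof -
  define hits where "hits m \<longleftrightarrow> (\<exists>k\<in>integer_lattice. x + k \<in> D m)" for m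
  have "\<exists>m. hits m"
    using D_exhausts zero_integer_lattice unfolding hits_def by (metis UNIV_I UN_E)
  define n where "n = (LEAST m. hits m)"
  have "hits n"
    unfolding n_def using \<open>\<exists>m. hits m\<close> by (rule LeastI_ex)
  have min: "\<not> hits m" if "m < n" for m
    using that not_less_Least unfolding n_def by blast
  show thesis
  proof (cases n)
    case 0
    then show thesis
      using \<open>hits n\<close> that by (auto simp: hits_def pretile_def)
  next
    case (Suc m)
    define F where "F = {k \<in> integer_lattice. x + k \<in> D n}"
    have "F = integer_lattice \<inter> ((+) (- x)) ` D n"
      by (auto simp: F_def image_iff algebra_simps)
    then have "finite F"
      by (simp only: finite_integer_lattice_Int_bounded bounded_translation[OF bounded_D])
    moreover have "F \<noteq> {}"
      using \<open>hits n\<close> by (auto simp: F_def hits_def)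
    ultimately obtain k where k: "k \<in> F"
      and le: "\<And>l. l \<in> F \<Longrightarrow> norm ((T ^^ m) (x + k)) \<le> norm ((T ^^ m) (x + l))"
      using ex_is_arg_min_if_finite[of F "\<lambda>k. norm ((T ^^ m) (x + k))"]
      unfolding is_arg_min_linorder by blast
    have "preferred m (x + k) (x + k + l)" if "l \<in> integer_lattice" for l
    proof -
      have kl: "k + l \<in> integer_lattice"
        using k that by (simp add: F_def integer_lattice_add)
      have "x + (k + l) \<notin> D m"
        using min[of m] kl Suc by (auto simp: hits_def)
      then show ?thesis
        using le[of "k + l"] kl Suc by (auto simp: preferred_def F_def add.assoc)
    qed
    then have "x + k \<in> shell_reps m"
      using k Suc by (simp add: F_def shell_reps_def)
    then show thesis
      using that k by (auto simp: F_def pretile_def)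
  qed
qed

text \<open>By compactness a single $D_M$ contains the unit cube, hence a translate of every point; a point
  outside $D_M$ is therefore never chosen.\<close>
lemma bounded_pretile: "bounded pretile"
proof -
  have "compact (cbox 0 (1 :: real ^ 'n))"
    by simp
  then obtain C where C: "finite C" "cbox 0 1 \<subseteq> (\<Union>m\<in>C. D m)"
    by (rule compactE_image[of _ UNIV D]) (simp_all add: open_D D_exhausts)
  define M where "M = Max C"
  have "(\<Union>m\<in>C. D m) \<subseteq> D M"
    unfolding M_def by (intro UN_least D_mono Max_ge C)
  then have M: "cbox 0 1 \<subseteq> D M"
    using C(2) by (rule order_trans[rotated])
  have "x \<in> D M" if x: "x \<in> shell_reps m" for x m
  proof (rule ccontr)
    assume "x \<notin> D M"
    moreover have "x \<in> D (Suc m)"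
      using x by (simp add: shell_reps_def)
    ultimately have "M \<le> m"
      using D_mono[of "Suc m" M] by (cases "M \<le> m") auto
    obtain k where "k \<in> integer_lattice" "x + k \<in> cbox 0 1"
      by (rule integer_lattice_translate_into_cube)
    then show False
      using x M D_mono[OF \<open>M \<le> m\<close>] by (auto simp: shell_reps_def preferred_def)
  qed
  then have "pretile \<subseteq> D M"
    using D_mono[of 0 M] by (auto simp: pretile_def)
  then show ?thesis
    using bounded_D bounded_subset by blast
qed

text \<open>The chosen set is not closed, since the order jumps at the boundaries of the shells.  Away from
  these boundaries the shell is locally constant and the length inside it is continuous, so that
  the inequalities defining the chosen points survive in the limit.\<close>
lemma closure_pretile_subset: "closure pretile \<subseteq> pretile \<union> (\<Union>m. frontier (D m))"
proof
  fix y assume y: "y \<in> closure pretile"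
  show "y \<in> pretile \<union> (\<Union>m. frontier (D m))"
  proof (cases "y \<in> D 0 \<or> y \<in> (\<Union>m. frontier (D m))")
    case False
    define n where "n = (LEAST m. y \<in> D m)"
    have "\<exists>m. y \<in> D m"
      using D_exhausts by blast
    then have "y \<in> D n"
      unfolding n_def by (rule LeastI_ex)
    then obtain m where n: "n = Suc m"
      using False by (cases n) auto
    then have "y \<notin> D m"
      using not_less_Least[of m "\<lambda>m. y \<in> D m"] by (simp add: n_def)
    then have "y \<notin> closure (D m)"
      using False open_D[of m] by (auto simp: frontier_def interior_open)
    \<comment> \<open>Near $y$ the shell is constant, so all late members of the sequence are compared in shell $m$.\<close>
    obtain s where s: "\<And>i. s i \<in> pretile" "s \<longlonglongrightarrow> y"
      using y by (auto simp: closure_sequential)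
    have ev_shell: "\<forall>\<^sub>F i in sequentially. s i \<in> D (Suc m) - closure (D m)"
      using s(2) \<open>y \<in> D n\<close> \<open>y \<notin> closure (D m)\<close> open_D[of "Suc m"]
      by (intro topological_tendstoD) (auto simp: n open_Diff)
    have "s i \<in> shell_reps m" if "s i \<in> D (Suc m) - closure (D m)" for i
    proof -
      have si: "s i \<in> D (Suc m)" "s i \<notin> D m"
        using that closure_subset by auto
      then have "s i \<notin> D 0"
        using D_mono[of 0 m] by auto
      then obtain m' where m': "s i \<in> shell_reps m'"
        using s(1)[of i] by (auto simp: pretile_def)
      then have "s i \<in> D (Suc m')" "s i \<notin> D m'"
        by (auto simp: shell_reps_def preferred_def dest: bspec[OF _ zero_integer_lattice])
      then have "m' = m"
        using si D_mono[of "Suc m'" m] D_mono[of "Suc m" m']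
        by (metis not_less_eq_eq order_antisym subsetD)
      then show ?thesis
        using m' by simp
    qed
    then have ev_rep: "\<forall>\<^sub>F i in sequentially. s i \<in> shell_reps m"
      using ev_shell by (auto elim: eventually_mono)
    have "preferred m y (y + k)" if k: "k \<in> integer_lattice" for k
    proof -
      have sk: "(\<lambda>i. s i + k) \<longlonglongrightarrow> y + k"
        by (intro tendsto_intros s)
      have ev: "\<forall>\<^sub>F i in sequentially. preferred m (s i) (s i + k)"
        using ev_rep by eventually_elim (use k in \<open>auto simp: shell_reps_def\<close>)
      have "y + k \<notin> D m"
      proof
        assume "y + k \<in> D m"
        then have "\<forall>\<^sub>F i in sequentially. s i + k \<in> D m"
          using topological_tendstoD[OF sk open_D] by blast
        then have "\<forall>\<^sub>F i in sequentially. False"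
          using ev by eventually_elim (simp add: preferred_def)
        then show False
          by simp
      qed
      moreover have "norm ((T ^^ m) y) \<le> norm ((T ^^ m) (y + k))" if "y + k \<in> D (Suc m)"
      proof -
        have cont: "(\<lambda>i. (T ^^ m) (f i)) \<longlonglongrightarrow> (T ^^ m) z" if "f \<longlonglongrightarrow> z" for f z
          using continuous_on_tendsto_compose[OF continuous_on_T_pow[of UNIV m] that] by simp
        have "\<forall>\<^sub>F i in sequentially. s i + k \<in> D (Suc m)"
          using topological_tendstoD[OF sk open_D] that by blast
        then have "\<forall>\<^sub>F i in sequentially. norm ((T ^^ m) (s i)) \<le> norm ((T ^^ m) (s i + k))"
          using ev by eventually_elim (simp add: preferred_def)
        then show ?thesis
          by (rule tendsto_le[OF sequentially_bot tendsto_norm[OF cont[OF sk]] tendsto_norm[OF cont[OF s(2)]]])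
      qed
      ultimately show ?thesis
        by (simp add: preferred_def)
    qed
    then have "y \<in> shell_reps m"
      using \<open>y \<in> D n\<close> by (simp add: shell_reps_def n)
    then show ?thesis
      by (auto simp: pretile_def)
  qed (auto simp: pretile_def)
qed

text \<open>Two chosen points of one coset do not come after each other, so they lie in the same shell and
  have the same length there; in $D_0$ there is at most one point of each coset.\<close>
lemma two_reps_imp_tie:
  assumes "x \<in> pretile" "x + k \<in> pretile" "k \<in> integer_lattice" "k \<noteq> 0"
  obtains m where "norm ((T ^^ m) x) = norm ((T ^^ m) (x + k))"
proof -
  have not0: "u \<notin> D 0" if ul: "u + l \<in> pretile" "l \<in> integer_lattice" "l \<noteq> 0" for u l
  proof
    assume u: "u \<in> D 0"
    then have "u + l \<notin> D 0"
      using packing[of u l] ul by (auto simp: D_0)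
    then obtain j where j: "u + l \<in> shell_reps j"
      using ul(1) by (auto simp: pretile_def)
    have "u + l + - l \<notin> D j"
      using j integer_lattice_minus[OF ul(2)] unfolding shell_reps_def preferred_def by blast
    then show False
      using u D_mono[of 0 j] by auto
  qed
  have "x \<notin> D 0" "x + k \<notin> D 0"
    using not0[of x k] not0[of "x + k" "- k"] assms by (auto simp: integer_lattice_minus)
  then obtain m m' where m: "x \<in> shell_reps m" and m': "x + k \<in> shell_reps m'"
    using assms by (auto simp: pretile_def)
  have pref: "preferred m x (x + k)" and "preferred m' (x + k) (x + k + - k)"
    using m m' assms(3) integer_lattice_minus[OF assms(3)] unfolding shell_reps_def by blast+
  then have pref': "preferred m' (x + k) x"
    by simp
  have "x \<in> D (Suc m)" "x + k \<in> D (Suc m')" "x + k \<notin> D m" "x \<notin> D m'"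
    using m m' pref pref' by (auto simp: shell_reps_def preferred_def)
  then have "m = m'"
    using D_mono[of "Suc m" m'] D_mono[of "Suc m'" m] by (metis not_less_eq_eq order_antisym subsetD)
  then have "norm ((T ^^ m) x) = norm ((T ^^ m) (x + k))"
    using pref pref' m m' by (intro order_antisym) (auto simp: preferred_def shell_reps_def)
  then show thesis
    by (rule that)
qed

text \<open>The map $T^m$ is linear and injective, so the quadratic terms cancel and the ties form a
  hyperplane.\<close>
lemma negligible_ties:
  assumes "k \<noteq> 0"
  shows "negligible {x. norm ((T ^^ m) x) = norm ((T ^^ m) (x + k))}"
proof -
  define w where "w = (T ^^ m) k"
  define a where "a = adjoint (T ^^ m) w"
  have a: "a \<bullet> x = w \<bullet> (T ^^ m) x" for x
    unfolding a_def using adjoint_works[OF linear_T_pow[of m], of x w] by (simp add: inner_commute)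
  have "w \<noteq> 0"
    using assms inj_T_pow[of m] linear_0[OF linear_T_pow[of m]] unfolding w_def by (metis injD)
  then have "a \<noteq> 0"
    using a[of k] by (auto simp: w_def)
  have "norm ((T ^^ m) x) = norm ((T ^^ m) (x + k)) \<longleftrightarrow> a \<bullet> x = - (w \<bullet> w) / 2" for x
    using inner_commute[of "(T ^^ m) x" w]
    by (auto simp: a norm_eq linear_add[OF linear_T_pow] inner_add_left inner_add_right w_def[symmetric])
  then show ?thesis
    using negligible_hyperplane[of a] \<open>a \<noteq> 0\<close> by simp
qed

text \<open>Passing to the closure adds only boundary points of the sets $D_m$, which are null because these
  sets are convex.  Outside countably many translates of null sets the translates of $x$ in the closure
  are thus exactly the chosen ones, of which there is one.\<close>
proposition exists_invariant_tile:
  "\<exists>K. compact K \<and> 0 \<in> interior K \<and> tiles K \<and> T ` K \<subseteq> K"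
proof (intro exI conjI)
  let ?K = "closure pretile" and ?L = "integer_lattice :: (real ^ 'n) set"
  show "compact ?K"
    using bounded_pretile by simp
  then have "?K \<in> sets lebesgue"
    by (simp add: lmeasurable_compact fmeasurableD)
  have "D 0 \<subseteq> ?K"
    using closure_subset by (auto simp: pretile_def)
  then show "0 \<in> interior ?K"
    using open_D zero_U D_0 by (metis interior_maximal subsetD)
  show "T ` ?K \<subseteq> ?K"
    using closure_linear_image_subset[OF linear_T] T_pretile closure_mono by (meson order_trans)

  \<comment> \<open>The second part collects the points with two tied translates $x + k$ and $x + k + l$.\<close>
  define N where "N = (\<Union>k\<in>?L. (+) (- k) ` (\<Union>m. frontier (D m))) \<union>
    (\<Union>k\<in>?L. \<Union>l\<in>?L - {0}. \<Union>m. (+) (- k) ` {x. norm ((T ^^ m) x) = norm ((T ^^ m) (x + l))})"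
  have frontiers: "negligible (\<Union>m. frontier (D m))"
    by (intro negligible_Union_countable_family negligible_convex_frontier convex_D) simp
  have "negligible N"
    unfolding N_def
    by (intro negligible_Un negligible_Union_countable_family negligible_translation frontiers negligible_ties)
      (auto simp: countable_integer_lattice)
  moreover have "((\<lambda>k. indicat_real ?K (x + k)) has_sum 1) ?L" if "x \<notin> N" for x
  proof -
    obtain k where k: "k \<in> ?L" "x + k \<in> pretile"
      by (rule pretile_covers)
    have in_pretile: "x + l \<in> pretile" if "l \<in> ?L" "x + l \<in> ?K" for l
    proof (rule ccontr)
      assume "x + l \<notin> pretile"
      then have "x + l \<in> (\<Union>m. frontier (D m))"
        using that closure_pretile_subset by blast
      then have "- l + (x + l) \<in> N"
        using that(1) unfolding N_def by blast
      then show False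
        using \<open>x \<notin> N\<close> by simp
    qed
    have "x + l \<notin> ?K" if l: "l \<in> ?L" "l \<noteq> k" for l
    proof
      assume "x + l \<in> ?K"
      then have "x + k + (l - k) \<in> pretile"
        using in_pretile l by simp
      then obtain m where "norm ((T ^^ m) (x + k)) = norm ((T ^^ m) (x + k + (l - k)))"
        using two_reps_imp_tie[of "x + k" "l - k"] k l by (auto simp: integer_lattice_diff)
      then have "- k + (x + k) \<in> (+) (- k) ` {x. norm ((T ^^ m) x) = norm ((T ^^ m) (x + (l - k)))}"
        by (intro imageI) simp
      moreover have "l - k \<in> ?L - {0}"
        using l k(1) by (simp add: integer_lattice_diff)
      ultimately have "- k + (x + k) \<in> N"
        using k(1) unfolding N_def by (intro UnI2 UN_I) auto
      then show False
        using \<open>x \<notin> N\<close> by simp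
    qed
    moreover have "x + k \<in> ?K"
      using k closure_subset by blast
    ultimately show ?thesis
      using k by (intro has_sum_finite_neutralI[of "{k}"]) (auto simp: indicator_def)
  qed
  ultimately have "AE x in lebesgue. ((\<lambda>k. indicat_real ?K (x + k)) has_sum 1) ?L"
    unfolding negligible_iff_null_sets by (intro AE_I'[of N]) auto
  then show "tiles ?K"
    using \<open>?K \<in> sets lebesgue\<close> by (simp add: tiles_def)
qed

end

section \<open>Tiles for expansive matrices\<close>

theorem proposition2p18:
  fixes A :: "int ^ 'n ^ 'n"
  assumes "expansive A"
  shows "\<exists>K :: (real ^ 'n) set. compact K \<and> 0 \<in> interior K \<and> tiles K \<and>
           K \<subseteq> (\<lambda>x. map_matrix real_of_int A *v x) ` K"
proof -
  obtain T :: "real ^ 'n \<Rightarrow> real ^ 'n" where T: "linear T"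
    "\<And>x. T (map_matrix real_of_int A *v x) = x" "\<And>x. map_matrix real_of_int A *v T x = x"
    "\<And>x. (\<lambda>m. (T ^^ m) x) \<longlonglongrightarrow> 0"
    using expansive_inverse_powers_tendsto_0[OF assms] by blast
  \<comment> \<open>The difference of two points of a ball of radius $1/2$ is shorter than any nonzero lattice vector.\<close>
  obtain U where U: "open U" "convex U" "U \<subseteq> ball 0 (1 / 2)" "0 \<in> U" "T ` U \<subseteq> U"
    using contracting_imp_invariant_neighbourhood[OF T(1) T(4), of "1 / 2"] by auto
  interpret lattice_contraction T "(*v) (map_matrix real_of_int A)" U
  proof (rule lattice_contraction.intro)
    show "bounded U"
      using U(3) bounded_ball bounded_subset by blast
    show "\<exists>m. (T ^^ m) x \<in> U" for x
      using topological_tendstoD[OF T(4) U(1,4)] by (auto simp: eventually_sequentially)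
    show "k = 0" if "x \<in> U" "x + k \<in> U" "k \<in> integer_lattice" for x k
    proof (rule integer_lattice_norm_less_1)
      have "norm x < 1 / 2" "norm (x + k) < 1 / 2"
        using that U(3) by auto
      then show "norm k < 1"
        using norm_triangle_ineq4[of "x + k" x] by simp
    qed (rule that)
  qed (fact T U matrix_vector_mul_linear matrix_maps_integer_lattice)+
  obtain K where K: "compact K" "0 \<in> interior K" "tiles K" "T ` K \<subseteq> K"
    using exists_invariant_tile by blast
  have "K \<subseteq> (\<lambda>x. map_matrix real_of_int A *v x) ` K"
  proof
    fix x assume "x \<in> K"
    then have "T x \<in> K"
      using K(4) by blast
    then show "x \<in> (\<lambda>x. map_matrix real_of_int A *v x) ` K"
      by (rule image_eqI[rotated]) (simp add: T(3))
  qed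
  then show ?thesis
    using K by blast
qed

end
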